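(* Let $X$ be a complete metric space and let $U:\{(t,s)\in\mathbb{R}^2:t\ge s\}\times X\to P(X)$ be a multivalued process which possesses a pullback attractor $\mathcal{A}=\{\mathcal{A}(t)\}_{t\in\mathbb{R}}$. Assume that $U$ is forward asymptotically compact. (i) If for any bounded set $B\subset X$ and any $t_0\in\mathbb{R}$ we have $\omega_f(B,t_0)\subset\omega_0(\mathcal{A})$, then $\mathcal{A}$ is a forward attractor and $\omega(\mathcal{A})=\omega_0(\mathcal{A})$. (ii) If $\mathcal{A}$ is a forward attractor, then $\omega_f(B,t_0)\subset\omega(\mathcal{A})$ for any $t_0\in\mathbb{R}$ and any bounded set $B\subset X$.
   Context: $P(X)$ is the set of non-empty subsets of $X$, $\rho$ the metric. For $A,B\subset X$, $dist(A,B)=\sup_{y\in A}\inf_{x\in B}\rho(y,x)$, and $dist(y,B)=dist(\{y\},B)$. A multivalued process satisfies: $U(s,s,x)=\{x\}$ for all $x,s$; and $U(t,s,x)\subset U(t,\tau,U(\tau,s,x))$ for all $x$ and $s\le\tau\le t$, where $U(t,s,B)=\bigcup_{x\in B}U(t,s,x)$. A family $\{K(t)\}_{t\in\mathbb{R}}$ is negatively invariant if $K(t)\subset U(t,s,K(s))$ for all $t\ge s$. A family of non-empty sets $\mathcal{A}=\{\mathcal{A}(t)\}$ is pullback attracting if for every bounded $B\subset X$ and every fixed $t$, $dist(U(t,t_0,B),\mathcal{A}(t))\to0$ as $t_0\to-\infty$; it is forward attracting if for every bounded $B\subset X$ and every fixed $t_0$, $dist(U(t,t_0,B),\mathcal{A}(t))\to0$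 as $t\to+\infty$. A pullback attractor is a family of non-empty compact negatively invariant sets that is the minimal pullback attracting family of closed sets (i.e. it is pullback attracting and contained, for each $t$, in any pullback attracting family of closed sets). A forward attractor is a family of non-empty compact negatively invariant sets that is forward attracting. $U$ is forward asymptotically compact if for every $t_0\in\mathbb{R}$, every bounded $B\subset X$ and all $t_n\to+\infty$, every sequence $y_n\in U(t_n,t_0,B)$ has a converging subsequence. Limit sets: $\omega_f(B,t_0)=\{y:y=\lim_{n\to\infty}y_n,\ y_n\in U(t_n,t_0,B),\ t_n\to+\infty\}$; $\omega(\mathcal{A})=\{y:y=\lim_{n\to\infty}y_n,\ y_n\in\mathcal{A}(t_n),\ t_n\to+\infty\}$; $\omega_0(\mathcal{A})=\{y\in X:\lim_{t\to+\infty}dist(y,\mathcal{A}(t))=0\}$. *)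

theory Defs
  imports "HOL-Analysis.Analysis"
begin

text \<open>
  A process is a total function whose value \<open>U t s x\<close> is meaningful only for \<open>s \<le> t\<close>. The values for
  \<open>t < s\<close> are junk, so every condition below restricts the times to \<open>s \<le> t\<close> or takes a limit in
  which this holds eventually.
\<close>

definition process_image :: "(real \<Rightarrow> real \<Rightarrow> 'a \<Rightarrow> 'a set) \<Rightarrow> real \<Rightarrow> real \<Rightarrow> 'a set \<Rightarrow> 'a set" where
  "process_image U t s B = (\<Union>x\<in>B. U t s x)"

definition multivalued_process :: "(real \<Rightarrow> real \<Rightarrow> 'a \<Rightarrow> 'a set) \<Rightarrow> bool" where
  "multivalued_process U \<longleftrightarrow>
     (\<forall>s t x. s \<le> t \<longrightarrow> U t s x \<noteq> {}) \<and>
     (\<forall>s x. U s s x = {x}) \<and>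
     (\<forall>s \<tau> t x. s \<le> \<tau> \<and> \<tau> \<le> t \<longrightarrow> U t s x \<subseteq> process_image U t \<tau> (U \<tau> s x))"

text \<open>
  The Hausdorff semidistance takes values in \<^typ>\<open>ennreal\<close>: the supremum over an unbounded set may be
  infinite, and the supremum over the empty set is 0.
\<close>

definition semidist :: "'a::metric_space set \<Rightarrow> 'a set \<Rightarrow> ennreal" where
  "semidist A B = (SUP y\<in>A. INF x\<in>B. ennreal (dist y x))"

definition negatively_invariant ::
    "(real \<Rightarrow> real \<Rightarrow> 'a \<Rightarrow> 'a set) \<Rightarrow> (real \<Rightarrow> 'a set) \<Rightarrow> bool" where
  "negatively_invariant U K \<longleftrightarrow> (\<forall>s t. s \<le> t \<longrightarrow> K t \<subseteq> process_image U t s (K s))"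

definition pullback_attracting ::
    "(real \<Rightarrow> real \<Rightarrow> 'a::metric_space \<Rightarrow> 'a set) \<Rightarrow> (real \<Rightarrow> 'a set) \<Rightarrow> bool" where
  "pullback_attracting U \<A> \<longleftrightarrow>
     (\<forall>t. \<A> t \<noteq> {}) \<and>
     (\<forall>B t. bounded B \<longrightarrow>
        ((\<lambda>t\<^sub>0. semidist (process_image U t t\<^sub>0 B) (\<A> t)) \<longlongrightarrow> 0) at_bot)"

definition forward_attracting ::
    "(real \<Rightarrow> real \<Rightarrow> 'a::metric_space \<Rightarrow> 'a set) \<Rightarrow> (real \<Rightarrow> 'a set) \<Rightarrow> bool" where
  "forward_attracting U \<A> \<longleftrightarrow>
     (\<forall>t. \<A> t \<noteq> {}) \<and>
     (\<forall>B t\<^sub>0. bounded B \<longrightarrow>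
        ((\<lambda>t. semidist (process_image U t t\<^sub>0 B) (\<A> t)) \<longlongrightarrow> 0) at_top)"

definition pullback_attractor ::
    "(real \<Rightarrow> real \<Rightarrow> 'a::metric_space \<Rightarrow> 'a set) \<Rightarrow> (real \<Rightarrow> 'a set) \<Rightarrow> bool" where
  "pullback_attractor U \<A> \<longleftrightarrow>
     (\<forall>t. \<A> t \<noteq> {} \<and> compact (\<A> t)) \<and>
     negatively_invariant U \<A> \<and>
     pullback_attracting U \<A> \<and>
     (\<forall>\<C>. (\<forall>t. closed (\<C> t)) \<and> pullback_attracting U \<C> \<longrightarrow> (\<forall>t. \<A> t \<subseteq> \<C> t))"

definition forward_attractor ::
    "(real \<Rightarrow> real \<Rightarrow> 'a::metric_space \<Rightarrow> 'a set) \<Rightarrow> (real \<Rightarrow> 'a set) \<Rightarrow> bool" where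
  "forward_attractor U \<A> \<longleftrightarrow>
     (\<forall>t. \<A> t \<noteq> {} \<and> compact (\<A> t)) \<and>
     negatively_invariant U \<A> \<and>
     forward_attracting U \<A>"

definition forward_asymptotically_compact ::
    "(real \<Rightarrow> real \<Rightarrow> 'a::metric_space \<Rightarrow> 'a set) \<Rightarrow> bool" where
  "forward_asymptotically_compact U \<longleftrightarrow>
     (\<forall>t\<^sub>0 B (t :: nat \<Rightarrow> real) y.
        bounded B \<and> (\<forall>n. t\<^sub>0 \<le> t n) \<and> filterlim t at_top sequentially \<and>
        (\<forall>n. y n \<in> process_image U (t n) t\<^sub>0 B)
        \<longrightarrow> (\<exists>l r. strict_mono (r :: nat \<Rightarrow> nat) \<and> (y \<circ> r) \<longlonglongrightarrow> l))"

definition omega_forward ::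
    "(real \<Rightarrow> real \<Rightarrow> 'a::metric_space \<Rightarrow> 'a set) \<Rightarrow> 'a set \<Rightarrow> real \<Rightarrow> 'a set" where
  "omega_forward U B t\<^sub>0 =
     {l. \<exists>(t :: nat \<Rightarrow> real) y.
        (\<forall>n. t\<^sub>0 \<le> t n) \<and> filterlim t at_top sequentially \<and>
        (\<forall>n. y n \<in> process_image U (t n) t\<^sub>0 B) \<and> y \<longlonglongrightarrow> l}"

definition omega_family :: "(real \<Rightarrow> 'a::metric_space set) \<Rightarrow> 'a set" where
  "omega_family \<A> =
     {l. \<exists>(t :: nat \<Rightarrow> real) y.
        filterlim t at_top sequentially \<and> (\<forall>n. y n \<in> \<A> (t n)) \<and> y \<longlonglongrightarrow> l}"

definition omega_zero :: "(real \<Rightarrow> 'a::metric_space set) \<Rightarrow> 'a set" where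
  "omega_zero \<A> = {y. ((\<lambda>t. semidist {y} (\<A> t)) \<longlongrightarrow> 0) at_top}"

end

theory Submission
  imports Defs
begin

text \<open>
  A failure of forward attraction yields times \<open>t\<^sub>n \<rightarrow> \<infinity>\<close> and points of \<open>U t\<^sub>n t\<^sub>0 B\<close> that stay a fixed
  distance away from \<open>\<A> t\<^sub>n\<close>; by asymptotic compactness a subsequence converges to a point of the
  forward limit set, which lies in \<open>omega_zero \<A>\<close>, a contradiction. Negative invariance places
  \<open>omega_family \<A>\<close> inside the forward limit set of the bounded set \<open>\<A> 0\<close>. Everything else follows
  from the fact that \<open>y\<close> lies in \<open>omega_family \<A>\<close> iff its distance to \<open>\<A> t\<^sub>n\<close> vanishes along some
  \<open>t\<^sub>n \<rightarrow> \<infinity>\<close>.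
\<close>

lemma infdist_almost_attained:
  assumes "A \<noteq> {}" and "0 < e"
  obtains x where "x \<in> A" and "dist y x < infdist y A + e"
proof -
  have "(INF x\<in>A. dist y x) < infdist y A + e"
    using assms by (simp add: infdist_notempty)
  then show thesis
    using that cInf_lessD[of "dist y ` A"] assms(1) by auto
qed

text \<open>Bridge from \<open>ennreal\<close> to the reals, where limits and the triangle
  inequality for \<open>infdist\<close> are available. Nonemptiness matters: over the empty set the
  infimum is \<open>top\<close>, while \<open>infdist\<close> defaults to 0.\<close>

lemma INF_dist_eq_infdist:
  assumes "A \<noteq> {}"
  shows "(INF x\<in>A. ennreal (dist y x)) = ennreal (infdist y A)"
proof (rule antisym)
  show "(INF x\<in>A. ennreal (dist y x)) \<le> ennreal (infdist y A)"
  proof (rule ennreal_le_epsilon)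
    fix e :: real assume "0 < e"
    then obtain x where "x \<in> A" "dist y x < infdist y A + e"
      using assms infdist_almost_attained by blast
    then have "(INF x\<in>A. ennreal (dist y x)) \<le> ennreal (infdist y A + e)"
      by (meson INF_lower2 ennreal_leI less_imp_le)
    then show "(INF x\<in>A. ennreal (dist y x)) \<le> ennreal (infdist y A) + ennreal e"
      using \<open>0 < e\<close> by (simp add: infdist_nonneg)
  qed
  show "ennreal (infdist y A) \<le> (INF x\<in>A. ennreal (dist y x))"
    by (intro INF_greatest ennreal_leI infdist_le)
qed

lemma semidist_eq_SUP_infdist:
  "B \<noteq> {} \<Longrightarrow> semidist A B = (SUP y\<in>A. ennreal (infdist y B))"
  by (simp add: semidist_def INF_dist_eq_infdist)

lemma infdist_le_semidist:
  "B \<noteq> {} \<Longrightarrow> y \<in> A \<Longrightarrow> ennreal (infdist y B) \<le> semidist A B"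
  by (simp add: semidist_eq_SUP_infdist) (rule SUP_upper)

lemma omega_zero_iff:
  assumes "\<And>t. \<A> t \<noteq> {}"
  shows "y \<in> omega_zero \<A> \<longleftrightarrow> ((\<lambda>t. infdist y (\<A> t)) \<longlongrightarrow> 0) at_top"
  using tendsto_ennreal_iff[of "\<lambda>t. infdist y (\<A> t)" at_top 0]
  by (simp add: omega_zero_def semidist_eq_SUP_infdist assms infdist_nonneg)

lemma omega_family_iff:
  assumes "\<And>t. \<A> t \<noteq> {}"
  shows "y \<in> omega_family \<A> \<longleftrightarrow>
    (\<exists>t :: nat \<Rightarrow> real. filterlim t at_top sequentially \<and> (\<lambda>n. infdist y (\<A> (t n))) \<longlonglongrightarrow> 0)"
proof
  assume "y \<in> omega_family \<A>"
  then obtain t :: "nat \<Rightarrow> real" and z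
    where t: "filterlim t at_top sequentially" and z: "\<And>n. z n \<in> \<A> (t n)" "z \<longlonglongrightarrow> y"
    unfolding omega_family_def by blast
  have "(\<lambda>n. infdist y (\<A> (t n))) \<longlonglongrightarrow> 0"
  proof (rule tendsto_sandwich[OF _ _ tendsto_const])
    show "\<forall>\<^sub>F n in sequentially. infdist y (\<A> (t n)) \<le> dist y (z n)"
      by (simp add: infdist_le z)
    show "(\<lambda>n. dist y (z n)) \<longlonglongrightarrow> 0"
      using tendsto_dist_iff[THEN iffD1, OF z(2)] by (simp add: dist_commute)
  qed (auto simp: infdist_nonneg)
  with t show "\<exists>t :: nat \<Rightarrow> real. filterlim t at_top sequentially \<and>
      (\<lambda>n. infdist y (\<A> (t n))) \<longlonglongrightarrow> 0"
    by blast
next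
  assume "\<exists>t :: nat \<Rightarrow> real. filterlim t at_top sequentially \<and>
      (\<lambda>n. infdist y (\<A> (t n))) \<longlonglongrightarrow> 0"
  then obtain t :: "nat \<Rightarrow> real" where t: "filterlim t at_top sequentially"
    and lim: "(\<lambda>n. infdist y (\<A> (t n))) \<longlonglongrightarrow> 0" by blast
  \<comment> \<open>The sets \<open>\<A> (t n)\<close> are arbitrary nonempty sets here, so a
    nearest point to \<open>y\<close> may not exist. A point that is nearest up to a vanishing error
    1/(n+1) serves as well.\<close>
  have "\<exists>z\<in>\<A> (t n). dist y z < infdist y (\<A> (t n)) + inverse (real (Suc n))" for n
    by (rule infdist_almost_attained[OF assms]) (auto simp del: of_nat_Suc)
  then obtain z where z: "\<And>n. z n \<in> \<A> (t n)"
    "\<And>n. dist y (z n) < infdist y (\<A> (t n)) + inverse (real (Suc n))" by metis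
  have "(\<lambda>n. dist y (z n)) \<longlonglongrightarrow> 0"
  proof (rule tendsto_sandwich[OF _ _ tendsto_const])
    show "(\<lambda>n. infdist y (\<A> (t n)) + inverse (real (Suc n))) \<longlonglongrightarrow> 0"
      using tendsto_add[OF lim LIMSEQ_inverse_real_of_nat] by simp
  qed (auto simp del: of_nat_Suc intro!: always_eventually less_imp_le[OF z(2)])
  then have "z \<longlonglongrightarrow> y"
    by (subst tendsto_dist_iff) (simp add: dist_commute)
  with t z(1) show "y \<in> omega_family \<A>"
    unfolding omega_family_def by blast
qed

text \<open>A limit over all times restricts to the integer times, which form one admissible
  sequence.\<close>

lemma omega_zero_subset_omega_family:
  assumes "\<And>t. \<A> t \<noteq> {}"
  shows "omega_zero \<A> \<subseteq> omega_family \<A>"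
proof
  fix y assume "y \<in> omega_zero \<A>"
  then have "((\<lambda>t. infdist y (\<A> t)) \<longlongrightarrow> 0) at_top"
    by (simp add: omega_zero_iff assms)
  then have "(\<lambda>n. infdist y (\<A> (real n))) \<longlonglongrightarrow> 0"
    using filterlim_real_sequentially by (rule filterlim_compose)
  with filterlim_real_sequentially show "y \<in> omega_family \<A>"
    unfolding omega_family_iff[of \<A>, OF assms] by blast
qed

lemma omega_family_subset_omega_forward:
  assumes "negatively_invariant U \<A>"
  shows "omega_family \<A> \<subseteq> omega_forward U (\<A> s) s"
proof
  fix y assume "y \<in> omega_family \<A>"
  then obtain t :: "nat \<Rightarrow> real" and z
    where t: "filterlim t at_top sequentially" and z: "\<And>n. z n \<in> \<A> (t n)" "z \<longlonglongrightarrow> y"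
    unfolding omega_family_def by blast
  \<comment> \<open>Negative invariance from time \<open>s\<close> speaks only of later times, and
    \<open>omega_forward\<close> asks for \<open>s \<le> t n\<close> at every index; hence the first
    \<open>N\<close> terms are dropped.\<close>
  from t have "\<forall>\<^sub>F n in sequentially. s \<le> t n"
    by (simp add: filterlim_at_top)
  then obtain N where N: "\<And>n. N \<le> n \<Longrightarrow> s \<le> t n"
    by (auto simp: eventually_sequentially)
  have "\<forall>n. s \<le> t (n + N)" by (simp add: N)
  moreover have "filterlim (\<lambda>n. t (n + N)) at_top sequentially"
    using t by (rule filterlim_compose) (rule filterlim_add_const_nat_at_top)
  moreover have "\<forall>n. z (n + N) \<in> process_image U (t (n + N)) s (\<A> s)"
    using assms N z(1) unfolding negatively_invariant_def
    by (meson le_add2 subsetD)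
  moreover have "(\<lambda>n. z (n + N)) \<longlonglongrightarrow> y"
    using z(2) by (rule LIMSEQ_ignore_initial_segment)
  ultimately show "y \<in> omega_forward U (\<A> s) s"
    unfolding omega_forward_def
    by (auto intro!: exI[of _ "\<lambda>n. t (n + N)"] exI[of _ "\<lambda>n. z (n + N)"])
qed

lemma forward_attracting_if_omega_forward_subset:
  assumes ne: "\<And>t. \<A> t \<noteq> {}"
    and compact: "forward_asymptotically_compact U"
    and sub: "\<And>B t\<^sub>0. bounded B \<Longrightarrow> omega_forward U B t\<^sub>0 \<subseteq> omega_zero \<A>"
  shows "forward_attracting U \<A>"
  unfolding forward_attracting_def
proof (intro conjI allI impI ne)
  fix B :: "'a set" and t\<^sub>0 :: real
  assume B: "bounded B"
  show "((\<lambda>t. semidist (process_image U t t\<^sub>0 B) (\<A> t)) \<longlongrightarrow> 0) at_top"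
  proof (rule ccontr)
    assume "\<not> ?thesis"
    then obtain e where e: "0 < e"
      "\<not> (\<forall>\<^sub>F t in at_top. semidist (process_image U t t\<^sub>0 B) (\<A> t) < e)"
      by (auto simp: order_tendsto_iff)
    \<comment> \<open>The bound \<open>e\<close> may be infinite. A smaller finite \<open>d\<close>
      allows real distances, and the strict gap turns \<open>e \<le> semidist\<close> into a single
      point of the image with \<open>infdist\<close> above \<open>d\<close>.\<close>
    obtain d :: real where d: "0 < d" "ennreal d < e"
    proof -
      obtain c where c: "0 < c" "c < e" using dense[OF e(1)] by blast
      then have "c < top" by (auto intro: order_less_le_trans)
      with c show thesis
        by (intro that[of "enn2real c"]) (auto simp: enn2real_positive_iff)
    qed
    \<comment> \<open>The maximum serves two ends: \<open>real n\<close> drives the times to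
      infinity, and \<open>t\<^sub>0\<close> keeps them where the process is meaningful.\<close>
    have "\<exists>t y. max t\<^sub>0 (real n) \<le> t \<and> y \<in> process_image U t t\<^sub>0 B \<and> d < infdist y (\<A> t)" for n
    proof -
      obtain t where t: "max t\<^sub>0 (real n) \<le> t" "e \<le> semidist (process_image U t t\<^sub>0 B) (\<A> t)"
        using e(2) unfolding eventually_at_top_linorder by (meson not_less)
      with d(2) have "ennreal d < semidist (process_image U t t\<^sub>0 B) (\<A> t)"
        by simp
      then show ?thesis
        using t(1) d(1) by (auto simp: semidist_eq_SUP_infdist ne less_SUP_iff ennreal_less_iff)
    qed
    then obtain t y where t: "\<And>n. max t\<^sub>0 (real n) \<le> t n"
      and y: "\<And>n. y n \<in> process_image U (t n) t\<^sub>0 B" "\<And>n. d < infdist (y n) (\<A> (t n))"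
      by metis
    have "filterlim t at_top sequentially"
      using t by (intro filterlim_at_top_mono[OF filterlim_real_sequentially]) auto
    moreover have t0: "\<And>n. t\<^sub>0 \<le> t n" using t by simp
    ultimately obtain l r where r: "strict_mono (r :: nat \<Rightarrow> nat)" and l: "(y \<circ> r) \<longlonglongrightarrow> l"
      using compact B y(1) unfolding forward_asymptotically_compact_def by blast
    have tr: "filterlim (t \<circ> r) at_top sequentially"
      unfolding comp_def using \<open>filterlim t at_top sequentially\<close> filterlim_subseq[OF r]
      by (rule filterlim_compose)
    have "l \<in> omega_forward U B t\<^sub>0"
      unfolding omega_forward_def using tr l t0 y(1)
      by (auto intro!: exI[of _ "t \<circ> r"] exI[of _ "y \<circ> r"])
    \<comment> \<open>Membership in \<open>omega_zero\<close> controls all large times, in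
      particular the times \<open>t (r n)\<close> already chosen; \<open>omega_family\<close> would
      supply only some sequence of its own.\<close>
    then have "((\<lambda>t. infdist l (\<A> t)) \<longlongrightarrow> 0) at_top"
      using sub[OF B] omega_zero_iff[of \<A>, OF ne] by blast
    then have "(\<lambda>n. infdist l (\<A> ((t \<circ> r) n))) \<longlonglongrightarrow> 0"
      using tr by (rule filterlim_compose)
    \<comment> \<open>This sum bounds the distance from \<open>y (r n)\<close> to
      \<open>\<A> (t (r n))\<close>, which exceeds \<open>d\<close> for every \<open>n\<close>; one
      small term is therefore a contradiction.\<close>
    then have "(\<lambda>n. infdist l (\<A> ((t \<circ> r) n)) + dist ((y \<circ> r) n) l) \<longlonglongrightarrow> 0 + 0"
      using tendsto_dist_iff[THEN iffD1, OF l] by (rule tendsto_add)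
    then have "\<forall>\<^sub>F n in sequentially. infdist l (\<A> ((t \<circ> r) n)) + dist ((y \<circ> r) n) l < d"
      using d(1) by (auto dest: order_tendstoD)
    then obtain n where "infdist l (\<A> ((t \<circ> r) n)) + dist ((y \<circ> r) n) l < d"
      by (auto simp: eventually_sequentially)
    moreover have "infdist ((y \<circ> r) n) (\<A> ((t \<circ> r) n))
        \<le> infdist l (\<A> ((t \<circ> r) n)) + dist ((y \<circ> r) n) l"
      by (rule infdist_triangle)
    ultimately show False
      using y(2)[of "r n"] by simp
  qed
qed

text \<open>Attraction brings \<open>y n\<close> close to \<open>\<A> (t n)\<close>, and the limit
  \<open>l\<close> inherits this by the triangle inequality. The control is along the given times
  \<open>t n\<close>, which is exactly the kind that \<open>omega_family\<close> asks for.\<close>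

lemma omega_forward_subset_omega_family:
  assumes "forward_attracting U \<A>" and "bounded B"
  shows "omega_forward U B t\<^sub>0 \<subseteq> omega_family \<A>"
proof
  fix l assume "l \<in> omega_forward U B t\<^sub>0"
  then obtain t :: "nat \<Rightarrow> real" and y where t: "filterlim t at_top sequentially"
    and y: "\<And>n. y n \<in> process_image U (t n) t\<^sub>0 B" "y \<longlonglongrightarrow> l"
    unfolding omega_forward_def by blast
  have ne: "\<And>t. \<A> t \<noteq> {}"
    using assms(1) by (simp add: forward_attracting_def)
  have "((\<lambda>t. semidist (process_image U t t\<^sub>0 B) (\<A> t)) \<longlongrightarrow> 0) at_top"
    using assms by (simp add: forward_attracting_def)
  then have "(\<lambda>n. semidist (process_image U (t n) t\<^sub>0 B) (\<A> (t n))) \<longlonglongrightarrow> 0"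
    using t by (rule filterlim_compose)
  then have "(\<lambda>n. ennreal (infdist (y n) (\<A> (t n)))) \<longlonglongrightarrow> ennreal 0"
    unfolding ennreal_0
    by (rule tendsto_sandwich[OF _ _ tendsto_const, rotated 2]) (auto simp: infdist_le_semidist ne y)
  then have "(\<lambda>n. infdist (y n) (\<A> (t n))) \<longlonglongrightarrow> 0"
    by (subst (asm) tendsto_ennreal_iff) (auto simp: infdist_nonneg)
  then have "(\<lambda>n. infdist (y n) (\<A> (t n)) + dist l (y n)) \<longlonglongrightarrow> 0 + 0"
    using tendsto_dist_iff[THEN iffD1, OF y(2)] by (intro tendsto_add) (simp_all add: dist_commute)
  then have "(\<lambda>n. infdist l (\<A> (t n))) \<longlonglongrightarrow> 0"
    unfolding add_0
    by (rule tendsto_sandwich[OF _ _ tendsto_const, rotated 2])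
      (simp_all add: infdist_nonneg infdist_triangle)
  with t show "l \<in> omega_family \<A>"
    unfolding omega_family_iff[of \<A>, OF ne] by blast
qed

theorem theorem21:
  fixes U :: "real \<Rightarrow> real \<Rightarrow> 'a::complete_space \<Rightarrow> 'a set"
    and \<A> :: "real \<Rightarrow> 'a set"
  assumes "multivalued_process U"
    and "pullback_attractor U \<A>"
    and "forward_asymptotically_compact U"
  shows "((\<forall>B t\<^sub>0. bounded B \<longrightarrow> omega_forward U B t\<^sub>0 \<subseteq> omega_zero \<A>)
            \<longrightarrow> forward_attractor U \<A> \<and> omega_family \<A> = omega_zero \<A>) \<and>
         (forward_attractor U \<A>
            \<longrightarrow> (\<forall>t\<^sub>0 B. bounded B \<longrightarrow> omega_forward U B t\<^sub>0 \<subseteq> omega_family \<A>))"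
proof (intro conjI impI)
  note attractor = assms(2)[unfolded pullback_attractor_def]
  have ne: "\<And>t. \<A> t \<noteq> {}" and cpt: "\<And>t. compact (\<A> t)"
    using attractor[THEN conjunct1] by simp_all
  have inv: "negatively_invariant U \<A>"
    using attractor by (elim conjE)
  assume sub: "\<forall>B t\<^sub>0. bounded B \<longrightarrow> omega_forward U B t\<^sub>0 \<subseteq> omega_zero \<A>"
  have "forward_attracting U \<A>"
    by (rule forward_attracting_if_omega_forward_subset[of \<A>, OF ne assms(3)]) (simp add: sub)
  with ne cpt inv show "forward_attractor U \<A>"
    by (simp add: forward_attractor_def)
  \<comment> \<open>The hypothesis is applied to a section of the attractor itself, which is bounded
    because it is compact; the forward limit set of that section is the middle term of the chain,
    and any initial time will do.\<close>
  have "omega_family \<A> \<subseteq> omega_zero \<A>"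
    using omega_family_subset_omega_forward[OF inv] sub[rule_format, OF compact_imp_bounded[OF cpt]]
    by (rule subset_trans)
  with omega_zero_subset_omega_family[of \<A>, OF ne] show "omega_family \<A> = omega_zero \<A>"
    by blast
next
  assume "forward_attractor U \<A>"
  then show "\<forall>t\<^sub>0 B. bounded B \<longrightarrow> omega_forward U B t\<^sub>0 \<subseteq> omega_family \<A>"
    by (simp add: forward_attractor_def omega_forward_subset_omega_family)
qed

end
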